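(* Let $l\in\mathbb{N}$, $\mathbf{p}=(p_1,\dots,p_l)\in\mathbb{N}^l$, $p=p_1+\cdots+p_l$, $\mathbf{h}\in\mathbb{C}^l$, $\alpha,\beta,e\in\mathbb{C}$, and let $d$ be a negative integer. Then $$ F\left(\begin{matrix}\alpha,\;\alpha+1/2,\;\Delta(d,2),\;\Delta(\mathbf{h}+\mathbf{p},2)\\\beta,\;\Delta(e,2),\;\Delta(\mathbf{h},2)\end{matrix}\,\Big|\,1\right) =C\cdot F\left(\begin{matrix}2\alpha,\;\beta-1/2,\;d,\;e\\2\beta-1,\;e,\;1+d-e+2\alpha+p\end{matrix}\;\vdots\;Y_p(1,1)\;\Big|\,2\right), $$ where $$ C=\frac{\Gamma(e-2\alpha-d)\,\Gamma(e)}{\Gamma(e-2\alpha)\,(\mathbf{h})_{\mathbf{p}}\,(1+d-e+2\alpha)_{p}} $$ and $Y_p(1,1)$ denotes the polynomial $t\mapsto Y_p(1,1;t)$ (defined in the context) with $\lambda=-2\alpha$.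
   Context: Notation: $(a)_n=\Gamma(a+n)/\Gamma(a)$; for vectors, $(\mathbf{a})_n=\prod_j(a_j)_n$, $(\mathbf{h})_{\mathbf{p}}=\prod_i(h_i)_{p_i}$, and $\mathbf{a}+\beta$ means adding $\beta$ to each component. $\Delta(a,2)=(a/2,(a+1)/2)$, applied component-wise to vectors. For a polynomial $P$, $$F\left(\begin{matrix}\mathbf{a}\\\mathbf{b}\end{matrix}\;\vdots\;P\;\Big|\;x\right)=\sum_{n\ge0}\frac{(\mathbf{a})_n}{(\mathbf{b})_n\,n!}P(n)x^n,$$ with $P\equiv1$ when omitted; an omitted argument means $x=1$. Standing convention: lower parameters are never non-positive integers, and all Gamma functions and denominators occurring are defined. $$ Y_p(u,v;t)=\frac{(\mathbf{h}-d)_{\mathbf{p}}}{\Gamma(e-d)}\sum_{j=0}^{p}\frac{(d-e+1)_{j}}{j!}\,F\left(\begin{matrix}-j,1-\mathbf{h}+d\\1-\mathbf{h}+d-\mathbf{p}\end{matrix}\right)(ut+d)_{j}\,(vt+d-e-\lambda+j+1)_{p-j}. $$ *)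

theory Defs
  imports "HOL-Analysis.Analysis" "HOL-Computational_Algebra.Polynomial"
begin

text \<open>
  Parameter vectors are lists. The symbol $(a)_n$ is \<^const>\<open>pochhammer\<close>, the polynomial
  $a(a+1)\cdots(a+n-1)$, which extends $\Gamma(a+n)/\Gamma(a)$ to the non-positive integers \<open>a\<close>
  (needed for the terminating upper parameters).
\<close>

definition poch_vec :: "complex list \<Rightarrow> nat \<Rightarrow> complex" where
  "poch_vec as n = (\<Prod>a\<leftarrow>as. pochhammer a n)"

definition poch_multi :: "complex list \<Rightarrow> nat list \<Rightarrow> complex" where
  "poch_multi hs ps = prod_list (map2 pochhammer hs ps)"

definition Delta2 :: "complex list \<Rightarrow> complex list" where
  "Delta2 as = concat (map (\<lambda>a. [a / 2, (a + 1) / 2]) as)"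

definition hypF_poly :: "complex list \<Rightarrow> complex list \<Rightarrow> complex poly \<Rightarrow> complex \<Rightarrow> complex" where
  "hypF_poly as bs P x =
     (\<Sum>n. poch_vec as n / (poch_vec bs n * fact n) * poly P (of_nat n) * x ^ n)"

abbreviation hypF :: "complex list \<Rightarrow> complex list \<Rightarrow> complex \<Rightarrow> complex" where
  "hypF as bs x \<equiv> hypF_poly as bs 1 x"

text \<open>
  \<open>Y_poly\<close> is $Y_p(u,v;t)$ as a polynomial in $t$: \<^const>\<open>pochhammer\<close> is taken in the polynomial
  ring, \<open>[:d, u:]\<close> being $ut+d$.
\<close>

definition Y_poly ::
  "complex list \<Rightarrow> nat list \<Rightarrow> complex \<Rightarrow> complex \<Rightarrow> complex \<Rightarrow> complex \<Rightarrow> complex \<Rightarrow> complex poly" where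
  "Y_poly hs ps d e lam u v =
     (let p = sum_list ps in
      smult (poch_multi (map (\<lambda>h. h - d) hs) ps / Gamma (e - d))
        (\<Sum>j\<le>p.
           smult (pochhammer (d - e + 1) j / fact j *
                  hypF (- of_nat j # map (\<lambda>h. 1 - h + d) hs)
                       (map2 (\<lambda>h q. 1 - h + d - of_nat q) hs ps) 1)
             (pochhammer [:d, u:] j *
              pochhammer [:d - e - lam + of_nat j + 1, v:] (p - j))))"

end

(* On the left-hand side only even powers occur: the n-th term is c_{2n} A_{2n}, where c_s/s! is the
   coefficient of z^s in the even function e^{-z} 1F1(b; 2b; 2z) with b = beta - 1/2 (Kummer's
   second transformation).  Writing c_s as a binomial sum over m and exchanging the two finite sums
   (everything terminates at N = -d) leaves, for each m, a terminating hypergeometric sum at 1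
   whose summand contains the polynomial s |-> (h + m + s)_p.  Expanding this polynomial in Newton's
   form around the last index s = N - m turns each Newton term into a Chu-Vandermonde sum, and the
   Newton coefficients are the terminating series F that occur in Y_p. *)

theory Submission
  imports Defs "HOL-Computational_Algebra.Formal_Power_Series"
begin

section \<open>Binomial sums\<close>

text \<open>Pascal's rule. With S the shift operator, the sum is the value at 0 of (1 + S)^(n+1) g,
  and one factor 1 + S is moved onto g.\<close>

lemma binomial_sum_Suc:
  fixes g :: "nat \<Rightarrow> 'a::comm_ring_1"
  shows "(\<Sum>k\<le>Suc n. of_nat (Suc n choose k) * g k)
       = (\<Sum>k\<le>n. of_nat (n choose k) * (g k + g (Suc k)))"
proof -
  have "(\<Sum>k\<le>Suc n. of_nat (Suc n choose k) * g k)
      = g 0 + (\<Sum>k\<le>n. of_nat (Suc n choose Suc k) * g (Suc k))"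
    by (subst sum.atMost_Suc_shift) simp
  also have "(\<Sum>k\<le>n. of_nat (Suc n choose Suc k) * g (Suc k))
      = (\<Sum>k\<le>n. of_nat (n choose k) * g (Suc k)) + (\<Sum>k\<le>n. of_nat (n choose Suc k) * g (Suc k))"
    by (simp add: algebra_simps sum.distrib)
  also have "g 0 + (\<dots>) = (\<Sum>k\<le>n. of_nat (n choose k) * g (Suc k))
      + (\<Sum>k\<le>Suc n. of_nat (n choose k) * g k)"
    by (subst sum.atMost_Suc_shift) simp
  also have "\<dots> = (\<Sum>k\<le>n. of_nat (n choose k) * (g k + g (Suc k)))"
    by (simp add: algebra_simps sum.distrib binomial_eq_0)
  finally show ?thesis .
qed

text \<open>Absorption, k C(n+1,k) = (n+1) C(n,k-1): a factor k in the summand lowers the order of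
  the sum by one.\<close>

lemma binomial_sum_absorb:
  fixes g :: "nat \<Rightarrow> 'a::comm_ring_1"
  shows "(\<Sum>k\<le>Suc n. of_nat (Suc n choose k) * (of_nat k * g k))
       = of_nat (Suc n) * (\<Sum>k\<le>n. of_nat (n choose k) * g (Suc k))"
proof -
  have "(\<Sum>k\<le>Suc n. of_nat (Suc n choose k) * (of_nat k * g k))
      = (\<Sum>k\<le>n. of_nat (Suc k * (Suc n choose Suc k)) * g (Suc k))"
    by (subst sum.atMost_Suc_shift) (simp only: of_nat_mult mult_ac, simp)
  also have "\<dots> = (\<Sum>k\<le>n. of_nat (Suc n * (n choose k)) * g (Suc k))"
    by (simp only: Suc_times_binomial)
  also have "\<dots> = of_nat (Suc n) * (\<Sum>k\<le>n. of_nat (n choose k) * g (Suc k))"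
    by (simp only: sum_distrib_left of_nat_mult mult.assoc)
  finally show ?thesis .
qed

text \<open>In terms of the shift S this is (1 - S)^n f at 0, that is (-1)^n times the n-th forward
  difference of f at 0.\<close>

definition alt_binomial_sum :: "(nat \<Rightarrow> 'a::comm_ring_1) \<Rightarrow> nat \<Rightarrow> 'a" where
  "alt_binomial_sum f n = (\<Sum>i\<le>n. of_nat (n choose i) * ((-1) ^ i * f i))"

lemma alt_binomial_sum_Suc:
  "alt_binomial_sum f (Suc n) = alt_binomial_sum f n - alt_binomial_sum (\<lambda>i. f (Suc i)) n"
  unfolding alt_binomial_sum_def binomial_sum_Suc
  by (simp add: algebra_simps sum_subtractf)

text \<open>Binomial inversion: the alternating transform is an involution. The induction varies f,
  since the value at n+1 is the value at n of the shifted sequence, whose transform is a difference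
  of consecutive transforms of f.\<close>

lemma alt_binomial_sum_inverse:
  "f n = alt_binomial_sum (alt_binomial_sum f) n"
proof (induction n arbitrary: f)
  case 0
  show ?case by (simp add: alt_binomial_sum_def)
next
  case (Suc n)
  have "f (Suc n) = alt_binomial_sum (alt_binomial_sum (\<lambda>i. f (Suc i))) n"
    by (rule Suc.IH)
  also have "(alt_binomial_sum (\<lambda>i. f (Suc i)))
      = (\<lambda>j. alt_binomial_sum f j - alt_binomial_sum f (Suc j))"
    by (simp add: fun_eq_iff alt_binomial_sum_Suc)
  also have "alt_binomial_sum \<dots> n = alt_binomial_sum (alt_binomial_sum f) (Suc n)"
    unfolding alt_binomial_sum_Suc[of "alt_binomial_sum f"]
    unfolding alt_binomial_sum_def[of _ n]
    by (simp add: algebra_simps sum_subtractf)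
  finally show ?case .
qed

text \<open>Differences of order above the degree vanish. Writing P = a + x Q, the constant dies in
  the alternating sum of binomials, and absorption turns x Q into an order-n sum of Q(x + 1), which
  has smaller degree.\<close>

lemma alt_binomial_sum_poly_eq_0:
  fixes P :: "'a::idom poly"
  assumes "degree P < n"
  shows "alt_binomial_sum (\<lambda>i. poly P (of_nat i)) n = 0"
  using assms
proof (induction n arbitrary: P)
  case 0
  then show ?case by simp
next
  case (Suc n)
  obtain a Q where P: "P = pCons a Q" by (cases P)
  have "alt_binomial_sum (\<lambda>i. poly P (of_nat i)) (Suc n)
      = a * (\<Sum>i\<le>Suc n. (-1) ^ i * of_nat (Suc n choose i))
        + (\<Sum>i\<le>Suc n. of_nat (Suc n choose i) * (of_nat i * ((-1) ^ i * poly Q (of_nat i))))"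
    unfolding alt_binomial_sum_def P sum_distrib_left sum.distrib[symmetric]
    by (intro sum.cong refl) (simp add: algebra_simps)
  also have "\<dots> = - of_nat (Suc n) * alt_binomial_sum (\<lambda>i. poly (pcompose Q [:1, 1:]) (of_nat i)) n"
    unfolding binomial_sum_absorb choose_alternating_sum[OF zero_less_Suc]
    by (simp add: alt_binomial_sum_def poly_pcompose sum_negf algebra_simps)
  also have "alt_binomial_sum (\<lambda>i. poly (pcompose Q [:1, 1:]) (of_nat i)) n = 0"
  proof (cases "Q = 0")
    case True
    then show ?thesis by (simp add: alt_binomial_sum_def)
  next
    case False
    then have "degree Q < n" using Suc.prems P by simp
    then show ?thesis using Suc.IH[of "pcompose Q [:1, 1:]"] by (simp add: degree_pcompose)
  qed
  finally show ?case by simp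
qed

lemma newton_expansion:
  fixes P :: "'a::idom poly"
  assumes "degree P \<le> p"
  shows "poly P (of_nat r)
       = (\<Sum>j\<le>p. of_nat (r choose j) * ((-1) ^ j * alt_binomial_sum (\<lambda>i. poly P (of_nat i)) j))"
    (is "_ = (\<Sum>j\<le>p. ?g j)")
proof -
  have "poly P (of_nat r) = (\<Sum>j\<le>r. ?g j)"
    using alt_binomial_sum_inverse[of "\<lambda>i. poly P (of_nat i)" r]
    unfolding alt_binomial_sum_def[of _ r] .
  \<comment> \<open>Either of r and p may be the larger: terms with j > r vanish by the binomial,
    terms with j > p by the degree bound.\<close>
  also have "\<dots> = (\<Sum>j\<le>max r p. ?g j)"
    by (rule sum.mono_neutral_left) (auto simp: not_le binomial_eq_0)
  also have "\<dots> = (\<Sum>j\<le>p. ?g j)"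
    by (rule sum.mono_neutral_right)
       (use assms in \<open>auto simp: alt_binomial_sum_poly_eq_0 not_le\<close>)
  finally show ?thesis .
qed

lemma pochhammer_neg_of_nat:
  "pochhammer (- of_nat n :: 'a::field_char_0) k = (-1) ^ k * (of_nat (n choose k) * fact k)"
proof -
  have "of_nat (n choose k) = (-1) ^ k * pochhammer (- of_nat n :: 'a) k / fact k"
    by (simp add: binomial_gbinomial gbinomial_pochhammer)
  then show ?thesis by simp
qed

section \<open>Hypergeometric sums\<close>

text \<open>The even part of Kummer's second transformation
  $e^{-z}\,{}_1F_1(b;2b;2z) = {}_0F_1(;b+1/2;z^2/4)$, read off coefficientwise.\<close>

lemma binomial_sum_pochhammer_double:
  fixes b :: "'a::field_char_0"
  assumes "\<And>n. 2 * b \<noteq> - of_nat n"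
  defines "c \<equiv> \<lambda>s. \<Sum>m\<le>s. of_nat (s choose m) * ((-2) ^ m * pochhammer b m / pochhammer (2 * b) m)"
  shows "c (2 * n) = pochhammer (1 / 2) n / pochhammer (b + 1 / 2) n" and "c (2 * n + 1) = 0"
proof -
  define t where "t = (\<lambda>m. (-2) ^ m * pochhammer b m / pochhammer (2 * b) m)"
  have nz: "2 * b + of_nat n \<noteq> 0" for n
    using assms(1)[of n] by (simp add: add_eq_0_iff2)
  have pnz: "pochhammer (2 * b) m \<noteq> 0" for m
    using assms(1) by (auto simp: pochhammer_eq_0_iff)
  \<comment> \<open>The ratio of consecutive terms, arranged for binomial summation: t m + t (m+1)
    sums by Pascal's rule to the next c, and the factor m is removed by absorption.\<close>
  have t_rec: "2 * b * (t m + t (Suc m)) + (of_nat m * (t (Suc m) + 2 * t m)) = 0" for m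
  proof -
    have "(2 * b + of_nat m) * t (Suc m) = - 2 * (b + of_nat m) * t m"
      using nz[of m] by (simp add: t_def pochhammer_Suc)
        (simp add: algebra_simps diff_divide_distrib add_divide_distrib)
    then show ?thesis by algebra
  qed
  have c_alt: "c s = (\<Sum>m\<le>s. of_nat (s choose m) * t m)" for s
    by (simp add: c_def t_def)
  have c_Suc: "c (Suc s) = (\<Sum>m\<le>s. of_nat (s choose m) * (t m + t (Suc m)))" for s
    unfolding c_alt binomial_sum_Suc ..
  have c_Suc2: "c (Suc (Suc s))
      = (\<Sum>m\<le>s. of_nat (s choose m) * (t m + 2 * t (Suc m) + t (Suc (Suc m))))" for s
    unfolding c_Suc binomial_sum_Suc by (simp add: algebra_simps)
  \<comment> \<open>Coefficient form of the Bessel-type equation z g'' + 2b g' = z g. It links only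
    indices of equal parity, so the odd coefficients vanish with c 1 = 1 - 2b/(2b), and the even
    ones form a product.\<close>
  have c_rec: "(2 * b + of_nat (Suc r)) * c (Suc (Suc r)) = of_nat (Suc r) * c r" for r
  proof -
    have "0 = (\<Sum>m\<le>Suc r. of_nat (Suc r choose m) *
                (2 * b * (t m + t (Suc m)) + of_nat m * (t (Suc m) + 2 * t m)))"
      by (simp only: t_rec) simp
    also have "\<dots> = 2 * b * c (Suc (Suc r))
        + (\<Sum>m\<le>Suc r. of_nat (Suc r choose m) * (of_nat m * (t (Suc m) + 2 * t m)))"
      unfolding c_Suc by (simp only: distrib_left sum.distrib sum_distrib_left mult_ac)
    also have "(\<Sum>m\<le>Suc r. of_nat (Suc r choose m) * (of_nat m * (t (Suc m) + 2 * t m)))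
        = of_nat (Suc r) * (\<Sum>m\<le>r. of_nat (r choose m) * (t (Suc (Suc m)) + 2 * t (Suc m)))"
      by (rule binomial_sum_absorb)
    also have "(\<Sum>m\<le>r. of_nat (r choose m) * (t (Suc (Suc m)) + 2 * t (Suc m)))
        = c (Suc (Suc r)) - c r"
      unfolding c_Suc2 c_alt[of r] sum_subtractf[symmetric]
      by (intro sum.cong refl) (simp add: algebra_simps)
    finally show ?thesis by (simp add: algebra_simps)
  qed
  show "c (2 * n + 1) = 0"
  proof (induction n)
    case 0
    then show ?case using nz[of 0] by (auto simp: c_def)
  next
    case (Suc n)
    then show ?case using c_rec[of "2 * n + 1"] nz[of "Suc (2 * n + 1)"] by (simp del: of_nat_Suc)
  qed
  show "c (2 * n) = pochhammer (1 / 2) n / pochhammer (b + 1 / 2) n"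
  proof (induction n)
    case 0
    then show ?case by (simp add: c_def)
  next
    case (Suc n)
    have half: "2 * b + of_nat (Suc (2 * n)) = 2 * (b + 1 / 2 + of_nat n)"
      "of_nat (Suc (2 * n)) = 2 * (1 / 2 + of_nat n :: 'a)"
      by (simp_all add: algebra_simps)
    have nz2: "b + 1 / 2 + of_nat n \<noteq> 0"
      using nz[of "Suc (2 * n)"] unfolding half(1) by (metis mult_zero_right)
    have "(b + 1 / 2 + of_nat n) * c (2 * Suc n) = (1 / 2 + of_nat n) * c (2 * n)"
      using c_rec[of "2 * n"] unfolding half(1) unfolding half(2) mult.assoc mult_cancel_left
      by simp
    then have "c (2 * Suc n) = (1 / 2 + of_nat n) * c (2 * n) / (b + 1 / 2 + of_nat n)"
      using nz2 by (metis nonzero_mult_div_cancel_left)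
    then show ?case unfolding Suc.IH pochhammer_Suc by (simp add: mult.commute)
  qed
qed

text \<open>Both (-n)_s (-(n-s))_j and (-n)_j (-(n-j))_s equal (-n)_(s+j). Hence the factor in j
  leaves the sum, and ordinary Chu-Vandermonde of order n - j remains. For j > n both sides are
  zero.\<close>

lemma chu_vandermonde_shifted:
  fixes a c :: "'a::field_char_0"
  assumes "\<And>i. c \<noteq> - of_nat i"
  shows "(\<Sum>s\<le>n. pochhammer a s * pochhammer (- of_nat n) s / (pochhammer c s * fact s)
             * pochhammer (- of_nat (n - s)) j)
       = pochhammer (- of_nat n) j * (pochhammer (c - a) (n - j) / pochhammer c (n - j))"
proof (cases "j \<le> n")
  case False
  have "pochhammer (- of_nat (n - s) :: 'a) j = 0" for s
    using False by (intro pochhammer_of_nat_eq_0_lemma) auto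
  moreover have "pochhammer (- of_nat n :: 'a) j = 0"
    using False by (intro pochhammer_of_nat_eq_0_lemma) auto
  ultimately show ?thesis by (simp del: of_nat_diff)
next
  case True
  have shift: "pochhammer (- of_nat n :: 'a) s * pochhammer (- of_nat (n - s)) j
      = pochhammer (- of_nat n) j * pochhammer (- of_nat (n - j)) s" if "s \<le> n" for s
  proof -
    have "- of_nat n + of_nat s = (- of_nat (n - s) :: 'a)"
      "- of_nat n + of_nat j = (- of_nat (n - j) :: 'a)"
      using that True by (auto simp: of_nat_diff)
    then show ?thesis
      using pochhammer_product'[of "- of_nat n :: 'a" s j] pochhammer_product'[of "- of_nat n :: 'a" j s]
      by (simp add: add.commute)
  qed
  have "(\<Sum>s\<le>n. pochhammer a s * pochhammer (- of_nat n) s / (pochhammer c s * fact s)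
             * pochhammer (- of_nat (n - s)) j)
      = (\<Sum>s\<le>n. pochhammer (- of_nat n) j *
           (pochhammer a s * pochhammer (- of_nat (n - j)) s / (pochhammer c s * fact s)))"
  proof (intro sum.cong refl)
    fix s assume "s \<in> {..n}"
    then have "pochhammer a s / (pochhammer c s * fact s) *
        (pochhammer (- of_nat n) s * pochhammer (- of_nat (n - s)) j)
      = pochhammer a s / (pochhammer c s * fact s) *
        (pochhammer (- of_nat n) j * pochhammer (- of_nat (n - j)) s)"
      using shift by simp
    then show "pochhammer a s * pochhammer (- of_nat n) s / (pochhammer c s * fact s)
             * pochhammer (- of_nat (n - s)) j
        = pochhammer (- of_nat n) j *
           (pochhammer a s * pochhammer (- of_nat (n - j)) s / (pochhammer c s * fact s))"
      by (simp add: mult_ac)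
  qed
  also have "\<dots> = pochhammer (- of_nat n) j *
      (\<Sum>s\<le>n. pochhammer a s * pochhammer (- of_nat (n - j)) s / (pochhammer c s * fact s))"
    by (simp add: sum_distrib_left)
  also have "(\<Sum>s\<le>n. pochhammer a s * pochhammer (- of_nat (n - j)) s / (pochhammer c s * fact s))
      = (\<Sum>s=0..n - j. pochhammer a s * pochhammer (- of_nat (n - j)) s / (fact s * pochhammer c s))"
    by (rule sum.mono_neutral_cong_right) (auto simp: pochhammer_of_nat_eq_0_lemma mult_ac)
  also have "\<dots> = pochhammer (c - a) (n - j) / pochhammer c (n - j)"
    using Vandermonde_pochhammer[of "n - j" c a] assms by simp
  finally show ?thesis .
qed

text \<open>The Newton basis in the reversed variable r = n - s consists of multiples of (-r)_j,
  exactly the factors that the shifted Chu-Vandermonde sum absorbs.\<close>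

lemma chu_vandermonde_poly:
  fixes a c :: "'a::field_char_0"
  assumes "\<And>i. c \<noteq> - of_nat i" and "degree P \<le> p"
  shows "(\<Sum>s\<le>n. pochhammer a s * pochhammer (- of_nat n) s / (pochhammer c s * fact s)
             * poly P (of_nat (n - s)))
       = (\<Sum>j\<le>p. alt_binomial_sum (\<lambda>i. poly P (of_nat i)) j / fact j * pochhammer (- of_nat n) j
             * (pochhammer (c - a) (n - j) / pochhammer c (n - j)))"
proof -
  define D where "D = alt_binomial_sum (\<lambda>i. poly P (of_nat i))"
  have newton: "poly P (of_nat r) = (\<Sum>j\<le>p. pochhammer (- of_nat r) j * (D j / fact j))" for r
    unfolding D_def pochhammer_neg_of_nat
    by (subst newton_expansion[OF assms(2)]) (intro sum.cong refl, simp)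
  have "(\<Sum>s\<le>n. pochhammer a s * pochhammer (- of_nat n) s / (pochhammer c s * fact s)
             * poly P (of_nat (n - s)))
      = (\<Sum>j\<le>p. D j / fact j * (\<Sum>s\<le>n. pochhammer a s * pochhammer (- of_nat n) s
             / (pochhammer c s * fact s) * pochhammer (- of_nat (n - s)) j))"
    unfolding newton sum_distrib_left
    by (subst sum.swap) (intro sum.cong refl, simp add: mult_ac)
  then show ?thesis
    unfolding chu_vandermonde_shifted[OF assms(1)] D_def by (simp only: mult.assoc)
qed

lemma pochhammer_reverse:
  "pochhammer (1 - z - of_nat n) n = (-1) ^ n * pochhammer (z :: 'a::comm_ring_1) n"
  using pochhammer_minus[of "z + of_nat n - 1" n] by (simp add: algebra_simps)

text \<open>Reversing the factors turns symbols in E and e that stop short of N into symbols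
  starting at 1 - E - N and 1 - e - N. The signs (-1)^(m+j) and (-1)^j so produced cancel against
  (-1)^m. The product form avoids any division.\<close>

lemma pochhammer_reflection_identity:
  fixes E e :: "'a::comm_ring_1"
  assumes "m + j \<le> N" and "j \<le> p"
  shows "(-1) ^ m * pochhammer E (N - m - j) * pochhammer e N * pochhammer (1 - E - of_nat N) (p + m)
       = pochhammer E N * pochhammer e (N - j) * pochhammer (1 - e - of_nat N) j
           * pochhammer (1 - E - of_nat N + of_nat (m + j)) (p - j)"
proof -
  have 1: "pochhammer E N = pochhammer E (N - m - j) * pochhammer (E + of_nat (N - m - j)) (m + j)"
    using pochhammer_product[of "N - m - j" N E] assms by simp
  have 2: "pochhammer e N = pochhammer e (N - j) * pochhammer (e + of_nat (N - j)) j"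
    using pochhammer_product[of "N - j" N e] assms by simp
  have 3: "pochhammer (1 - E - of_nat N) (p + m)
      = pochhammer (1 - E - of_nat N) (m + j) * pochhammer (1 - E - of_nat N + of_nat (m + j)) (p - j)"
    using pochhammer_product[of "m + j" "p + m" "1 - E - of_nat N"] assms by simp
  have 4: "pochhammer (1 - E - of_nat N) (m + j)
      = (-1) ^ (m + j) * pochhammer (E + of_nat (N - m - j)) (m + j)"
    using pochhammer_reverse[of "E + of_nat (N - m - j)" "m + j"] assms
    by (simp add: of_nat_diff algebra_simps)
  have 5: "pochhammer (1 - e - of_nat N) j = (-1) ^ j * pochhammer (e + of_nat (N - j)) j"
    using pochhammer_reverse[of "e + of_nat (N - j)" j] assms
    by (simp add: of_nat_diff algebra_simps)
  have 6: "(-1) ^ m * (-1) ^ (m + j) = ((-1) ^ j :: 'a)"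
    by (simp add: power_add mult.assoc[symmetric] power_mult_distrib[symmetric])
  have "(-1) ^ m * pochhammer E (N - m - j) * pochhammer e N * pochhammer (1 - E - of_nat N) (p + m)
      = ((-1) ^ m * (-1) ^ (m + j)) * pochhammer E N * pochhammer e N
          * pochhammer (1 - E - of_nat N + of_nat (m + j)) (p - j)"
    unfolding 3 4 1 by (simp only: mult_ac)
  also have "\<dots> = pochhammer E N * pochhammer e (N - j) * pochhammer (1 - e - of_nat N) j
           * pochhammer (1 - E - of_nat N + of_nat (m + j)) (p - j)"
    unfolding 6 5 2 by (simp only: mult_ac)
  finally show ?thesis .
qed

section \<open>Parameter vectors\<close>

lemma poch_vec_Nil [simp]: "poch_vec [] n = 1"
  and poch_vec_Cons [simp]: "poch_vec (a # as) n = pochhammer a n * poch_vec as n"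
  and poch_vec_append: "poch_vec (as @ bs) n = poch_vec as n * poch_vec bs n"
  by (simp_all add: poch_vec_def)

lemma poch_vec_eq_0_iff: "poch_vec as n = 0 \<longleftrightarrow> (\<exists>a\<in>set as. pochhammer a n = 0)"
  by (induction as) auto

text \<open>The duplication formula in each component; it exhibits the halved parameters as symbols
  of even index 2n.\<close>

lemma poch_vec_Delta2: "poch_vec (Delta2 as) n = poch_vec as (2 * n) / 4 ^ (n * length as)"
proof (induction as)
  case Nil
  then show ?case by (simp add: Delta2_def)
next
  case (Cons a as)
  have "pochhammer a (2 * n) = 4 ^ n * (pochhammer (a / 2) n * pochhammer ((a + 1) / 2) n)"
    using pochhammer_double[of "a / 2" n] by (simp add: power_mult add_divide_distrib)
  moreover have "poch_vec (Delta2 (a # as)) n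
      = pochhammer (a / 2) n * pochhammer ((a + 1) / 2) n * poch_vec (Delta2 as) n"
    by (simp add: Delta2_def)
  ultimately show ?case using Cons.IH by (simp add: power_add field_simps)
qed

text \<open>Splitting (h)_(q+n) in two ways. It makes the ratio of the symbols of h + p and h a
  polynomial in n.\<close>

lemma poch_vec_shift:
  assumes "length hs = length ps"
  shows "poch_vec (map2 (\<lambda>h q. h + of_nat q) hs ps) n * poch_multi hs ps
       = poch_vec hs n * poch_multi (map (\<lambda>h. h + of_nat n) hs) ps"
  using assms
proof (induction hs ps rule: list_induct2)
  case Nil
  then show ?case by (simp add: poch_multi_def)
next
  case (Cons h hs q ps)
  have "pochhammer (h + of_nat q) n * pochhammer h q = pochhammer h n * pochhammer (h + of_nat n) q"
    using pochhammer_product'[of h q n] pochhammer_product'[of h n q] by (simp add: add.commute mult.commute)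
  with Cons.IH show ?case by (simp add: poch_multi_def) algebra
qed

text \<open>The same splitting after reversing factors; the signs (-1)^r agree on both sides. It
  makes the parameter ratio of the inner series of Y_p a polynomial in r.\<close>

lemma poch_vec_reflect:
  assumes "length xs = length ps"
  shows "poch_vec (map (\<lambda>x. 1 - x) xs) r * poch_multi xs ps
       = poch_vec (map2 (\<lambda>x q. 1 - x - of_nat q) xs ps) r * poch_multi (map (\<lambda>x. x - of_nat r) xs) ps"
  using assms
proof (induction xs ps rule: list_induct2)
  case Nil
  then show ?case by (simp add: poch_multi_def)
next
  case (Cons x xs q ps)
  have 1: "pochhammer (1 - x) r = (-1) ^ r * pochhammer (x - of_nat r) r"
    using pochhammer_reverse[of "x - of_nat r" r] by simp
  have 2: "pochhammer (1 - x - of_nat q) r = (-1) ^ r * pochhammer (x + of_nat q - of_nat r) r"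
    using pochhammer_reverse[of "x + of_nat q - of_nat r" r] by (simp add: algebra_simps)
  have 3: "pochhammer (x - of_nat r) r * pochhammer x q
      = pochhammer (x - of_nat r) q * pochhammer (x + of_nat q - of_nat r) r"
    using pochhammer_product'[of "x - of_nat r" r q] pochhammer_product'[of "x - of_nat r" q r]
    by (simp add: algebra_simps)
  have "pochhammer (1 - x) r * pochhammer x q
      = pochhammer (1 - x - of_nat q) r * pochhammer (x - of_nat r) q"
    unfolding 1 2 using 3 by simp
  with Cons.IH show ?case by (simp add: poch_multi_def) algebra
qed

lemma poly_pochhammer:
  fixes P :: "'a::comm_semiring_1 poly"
  shows "poly (pochhammer P n) x = pochhammer (poly P x) n"
  by (induction n) (simp_all add: pochhammer_Suc of_nat_poly)

lemma degree_pochhammer_linear: "degree (pochhammer [:a, b:] n) \<le> n"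
proof (induction n)
  case (Suc n)
  have "degree ([:a, b:] + of_nat n) \<le> 1"
    by (simp add: of_nat_poly)
  then show ?case
    using Suc degree_mult_le[of "pochhammer [:a, b:] n" "[:a, b:] + of_nat n"]
    by (simp add: pochhammer_Suc)
qed simp

lemma poch_multi_poly:
  "\<exists>P. degree P \<le> sum_list ps \<and> (\<forall>x. poly P x = poch_multi (map (\<lambda>h. h - x) hs) ps)"
proof (induction hs arbitrary: ps)
  case Nil
  show ?case by (rule exI[of _ 1]) (simp add: poch_multi_def)
next
  case (Cons h hs)
  show ?case
  proof (cases ps)
    case Nil
    \<comment> \<open>With no exponents left \<open>map2\<close> yields the empty list, hence the
      product 1.\<close>
    show ?thesis by (rule exI[of _ 1]) (simp add: poch_multi_def Nil)
  next
    case (Cons q qs)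
    obtain P where P: "degree P \<le> sum_list qs" "\<And>x. poly P x = poch_multi (map (\<lambda>h. h - x) hs) qs"
      using Cons.IH by blast
    have "degree (pochhammer [:h, -1:] q * P) \<le> sum_list ps"
      using P(1) degree_mult_le[of "pochhammer [:h, -1:] q" P] degree_pochhammer_linear[of h "-1" q]
      by (simp add: Cons)
    moreover have "poly (pochhammer [:h, -1:] q * P) x = poch_multi (map (\<lambda>h. h - x) (h # hs)) ps" for x
      by (simp add: poly_pochhammer P(2) Cons poch_multi_def)
    ultimately show ?thesis by blast
  qed
qed

section \<open>The transformation\<close>

theorem mainTheorem9:
  fixes l :: nat and ps :: "nat list" and hs :: "complex list"
    and \<alpha> \<beta> e d :: complex and k :: int and p :: nat
  assumes "length ps = l" and "length hs = l"
    and "p = sum_list ps"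
    and "d = of_int k" and "k < 0"
    \<comment> \<open>no lower parameter is a non-positive integer\<close>
    and "set (\<beta> # Delta2 [e] @ Delta2 hs) \<inter> \<int>\<^sub>\<le>\<^sub>0 = {}"
    and "set [2 * \<beta> - 1, e, 1 + d - e + 2 * \<alpha> + of_nat p] \<inter> \<int>\<^sub>\<le>\<^sub>0 = {}"
    and "set (map2 (\<lambda>h q. 1 - h + d - of_nat q) hs ps) \<inter> \<int>\<^sub>\<le>\<^sub>0 = {}"
    \<comment> \<open>the Gamma functions and quotients are defined\<close>
    and "{e - 2 * \<alpha> - d, e, e - 2 * \<alpha>, e - d} \<inter> \<int>\<^sub>\<le>\<^sub>0 = {}"
    and "poch_multi hs ps \<noteq> 0"
    and "pochhammer (1 + d - e + 2 * \<alpha>) p \<noteq> 0"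
  shows "hypF ([\<alpha>, \<alpha> + 1/2] @ Delta2 [d] @ Delta2 (map2 (\<lambda>h q. h + of_nat q) hs ps))
              (\<beta> # Delta2 [e] @ Delta2 hs) 1
       = Gamma (e - 2 * \<alpha> - d) * Gamma e /
           (Gamma (e - 2 * \<alpha>) * poch_multi hs ps * pochhammer (1 + d - e + 2 * \<alpha>) p)
         * hypF_poly [2 * \<alpha>, \<beta> - 1/2, d, e] [2 * \<beta> - 1, e, 1 + d - e + 2 * \<alpha> + of_nat p]
             (Y_poly hs ps d e (- 2 * \<alpha>) 1 1) 2"
proof -
  define N where "N = nat (- k)"
  have d: "d = - of_nat N"
    using assms(4,5) by (simp add: N_def)
  \<comment> \<open>With this b, 2b is the lower parameter 2\<beta> - 1 and b + 1/2 = \<beta>, as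
    Kummer's transformation requires.\<close>
  define b where "b = \<beta> - 1 / 2"
  define K where "K = poch_multi hs ps"
  define R where "R = (\<lambda>x. poch_multi (map (\<lambda>h. h + x) hs) ps)"
  \<comment> \<open>The difference c - a in the later Chu-Vandermonde sums, where c = e + m and a =
    2\<alpha> + m; it does not depend on m.\<close>
  define E where "E = e - 2 * \<alpha>"
  have len: "length hs = length ps"
    using assms(1,2) by simp
  have K0: "K \<noteq> 0"
    using assms(10) by (simp add: K_def)
  have not_nonpos: "z \<noteq> - of_nat i" if "z \<notin> \<int>\<^sub>\<le>\<^sub>0" for z :: complex and i
    using that by auto
  have poch_nz: "pochhammer z i \<noteq> 0" if "z \<notin> \<int>\<^sub>\<le>\<^sub>0" for z :: complex and i
    using that not_nonpos by (auto simp: pochhammer_eq_0_iff)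
  have nonpos: "2 * b \<notin> \<int>\<^sub>\<le>\<^sub>0" "e \<notin> \<int>\<^sub>\<le>\<^sub>0" "E \<notin> \<int>\<^sub>\<le>\<^sub>0" "1 + d - e + 2 * \<alpha> + of_nat p \<notin> \<int>\<^sub>\<le>\<^sub>0"
    using assms(7,9) by (auto simp: b_def E_def algebra_simps)
  have E_shift: "1 + d - e + 2 * \<alpha> = 1 - E - of_nat N"
    by (simp add: E_def d)

  \<comment> \<open>The general term of the series with undoubled parameters 2\<alpha>, d, h + p
    over e, h at argument 1, its h-ratio written as R(s)/K.\<close>
  define A where "A = (\<lambda>s. pochhammer (2 * \<alpha>) s * pochhammer d s * R (of_nat s)
      / (pochhammer e s * fact s * K))"
  have A_eq_0: "A s = 0" if "s > N" for s
    using that by (simp add: A_def d pochhammer_of_nat_eq_0_lemma)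
  define c where "c = (\<lambda>s. \<Sum>m\<le>s. of_nat (s choose m) *
      ((-2) ^ m * pochhammer b m / pochhammer (2 * b) m))"
  have c_even: "c (2 * n) = pochhammer (1 / 2) n / pochhammer \<beta> n"
    and c_odd: "c (2 * n + 1) = 0" for n
    using binomial_sum_pochhammer_double[of b n] not_nonpos[OF nonpos(1)]
    by (simp_all add: c_def b_def)

  \<comment> \<open>The left-hand series as a sum over even indices\<close>
  have lhs_term: "poch_vec ([\<alpha>, \<alpha> + 1/2] @ Delta2 [d] @ Delta2 (map2 (\<lambda>h q. h + of_nat q) hs ps)) n
      / (poch_vec (\<beta> # Delta2 [e] @ Delta2 hs) n * fact n) = c (2 * n) * A (2 * n)" for n
  proof -
    have hs_nz: "poch_vec hs (2 * n) \<noteq> 0"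
    proof -
      have "poch_vec (Delta2 hs) n \<noteq> 0"
        using assms(6) poch_nz by (auto simp: poch_vec_eq_0_iff)
      then show ?thesis by (simp add: poch_vec_Delta2)
    qed
    have R: "poch_vec (map2 (\<lambda>h q. h + of_nat q) hs ps) (2 * n) = poch_vec hs (2 * n) * R (of_nat (2 * n)) / K"
      using poch_vec_shift[OF len, of "2 * n"] K0 by (simp add: R_def K_def eq_divide_eq mult.commute)
    have \<alpha>: "pochhammer \<alpha> n * pochhammer (\<alpha> + 1 / 2) n = pochhammer (2 * \<alpha>) (2 * n) / 4 ^ n"
      using pochhammer_double[of \<alpha> n] by (simp add: power_mult)
    \<comment> \<open>After the duplications for \<alpha>, d, e and the h-vectors one factor 4^(-n)
      is left over. It combines with n! into (2n)!, producing the (1/2)_n of c (2n).\<close>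
    have half: "(fact (2 * n) :: complex) = 4 ^ n * (pochhammer (1 / 2) n * fact n)"
      using pochhammer_double[of "1 / 2 :: complex" n]
      by (simp add: power_mult pochhammer_fact mult.assoc mult.commute[of "pochhammer 1 n"])
    have len': "length (map2 (\<lambda>h q. h + of_nat q) hs ps) = length hs"
      using len by simp
    have "pochhammer (1 / 2 :: complex) n \<noteq> 0"
      using half fact_nonzero[of "2 * n", where ?'a = complex] by auto
    moreover have "\<beta> \<notin> \<int>\<^sub>\<le>\<^sub>0"
      using assms(6) by auto
    moreover have "x / X * (y / X * (h * r / K / Z)) / (B * (z / X * (h / Z)) * f)
        = g / B * (x * y * r / (z * (X * (g * f)) * K))"
      if "X \<noteq> 0" "Z \<noteq> 0" "h \<noteq> 0" "g \<noteq> 0" "B \<noteq> 0" "z \<noteq> 0" "f \<noteq> 0"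
      for x y z X Z h r B f g :: complex
      using that K0 by (simp add: divide_simps)
    ultimately show ?thesis
      unfolding poch_vec_append poch_vec_Delta2 poch_vec_Cons poch_vec_Nil len' R c_even A_def half
      using poch_nz[OF nonpos(2)] poch_nz[of \<beta>] hs_nz by (simp add: \<alpha>)
  qed

  \<comment> \<open>Exchange of summation and evaluation of the inner sums\<close>
  define t where "t = (\<lambda>m. pochhammer (2 * \<alpha>) m * pochhammer b m * pochhammer d m
      / (pochhammer (2 * b) m * fact m))"
  \<comment> \<open>Here i is the distance N - s from the last index s of the terminating sum, since
    h - d - i = h + s. Up to sign, \<open>D j\<close> is the j-th Newton coefficient there.\<close>
  define D where "D = alt_binomial_sum (\<lambda>i. poch_multi (map (\<lambda>h. h - d - of_nat i) hs) ps)"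
  define W where "W = (\<lambda>m j. D j / fact j * pochhammer (- of_nat (N - m)) j
      * (pochhammer E (N - m - j) / pochhammer (e + of_nat m) (N - m - j)))"

  have inner: "(\<Sum>i\<le>N - m. of_nat ((m + i) choose m) *
        ((-2) ^ m * pochhammer b m / pochhammer (2 * b) m) * A (m + i))
      = t m * (-2) ^ m / (pochhammer e m * K) * (\<Sum>j\<le>p. W m j)" if "m \<le> N" for m
  proof -
    obtain P where P: "degree P \<le> p" "\<And>x. poly P x = poch_multi (map (\<lambda>h. h - x) (map (\<lambda>h. h - d) hs)) ps"
      using poch_multi_poly[of ps "map (\<lambda>h. h - d) hs"] assms(3) by blast
    have em: "e + of_nat m \<noteq> - of_nat i" for i
      using not_nonpos[OF nonpos(2), of "m + i"] by (auto simp: algebra_simps eq_neg_iff_add_eq_0)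
    \<comment> \<open>The binomial turns (m+i)! into m! i!, and (a)_(m+i) = (a)_m (a+m)_i separates
      what depends on m alone. The rest is a Chu-Vandermonde summand of order N - m times a
      polynomial at N - m - i.\<close>
    have summand: "of_nat ((m + i) choose m) *
        ((-2) ^ m * pochhammer b m / pochhammer (2 * b) m) * A (m + i)
      = t m * (-2) ^ m / (pochhammer e m * K) *
        (pochhammer (2 * \<alpha> + of_nat m) i * pochhammer (- of_nat (N - m)) i
          / (pochhammer (e + of_nat m) i * fact i) * poly P (of_nat (N - m - i)))"
      if i: "i \<le> N - m" for i
    proof -
      have R: "poly P (of_nat (N - m - i)) = R (of_nat (m + i))"
      proof -
        have arg: "h - d - of_nat (N - m - i) = h + of_nat (m + i)" for h
          using i \<open>m \<le> N\<close> by (simp add: d of_nat_diff)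
        show ?thesis
          unfolding P(2) R_def map_map o_def arg ..
      qed
      have dm: "d + of_nat m = - of_nat (N - m)"
        using \<open>m \<le> N\<close> by (simp add: d of_nat_diff)
      have fact: "fact (m + i) = (of_nat ((m + i) choose m) * (fact m * fact i) :: complex)"
        by (simp add: binomial_fact)
      have choose: "of_nat ((m + i) choose m) \<noteq> (0 :: complex)"
        by simp
      show ?thesis
        unfolding R A_def t_def pochhammer_product'[of _ m i] dm fact
        using choose by (simp add: mult_ac)
    qed
    have "(\<Sum>i\<le>N - m. of_nat ((m + i) choose m) *
        ((-2) ^ m * pochhammer b m / pochhammer (2 * b) m) * A (m + i))
      = t m * (-2) ^ m / (pochhammer e m * K) *
        (\<Sum>i\<le>N - m. pochhammer (2 * \<alpha> + of_nat m) i * pochhammer (- of_nat (N - m)) i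
          / (pochhammer (e + of_nat m) i * fact i) * poly P (of_nat (N - m - i)))"
      unfolding sum_distrib_left by (intro sum.cong refl summand) simp
    also have "(\<Sum>i\<le>N - m. pochhammer (2 * \<alpha> + of_nat m) i * pochhammer (- of_nat (N - m)) i
          / (pochhammer (e + of_nat m) i * fact i) * poly P (of_nat (N - m - i)))
        = (\<Sum>j\<le>p. W m j)"
    proof -
      have "(\<lambda>i. poly P (of_nat i)) = (\<lambda>i. poch_multi (map (\<lambda>h. h - d - of_nat i) hs) ps)"
        by (simp add: P(2) o_def)
      then show ?thesis
        unfolding chu_vandermonde_poly[OF em P(1)] W_def D_def E_def by simp
    qed
    finally show ?thesis .
  qed

  have lhs: "hypF ([\<alpha>, \<alpha> + 1/2] @ Delta2 [d] @ Delta2 (map2 (\<lambda>h q. h + of_nat q) hs ps))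
              (\<beta> # Delta2 [e] @ Delta2 hs) 1
      = (\<Sum>m\<le>N. t m * (-2) ^ m / (pochhammer e m * K) * (\<Sum>j\<le>p. W m j))"
  proof -
    have "hypF ([\<alpha>, \<alpha> + 1/2] @ Delta2 [d] @ Delta2 (map2 (\<lambda>h q. h + of_nat q) hs ps))
              (\<beta> # Delta2 [e] @ Delta2 hs) 1 = (\<Sum>n. c (2 * n) * A (2 * n))"
      unfolding hypF_poly_def lhs_term by simp
    also have "\<dots> = (\<Sum>n<Suc N. c (2 * n) * A (2 * n))"
      by (rule suminf_finite) (auto simp: A_eq_0)
    \<comment> \<open>The odd terms may be added because \<open>c\<close> vanishes there.\<close>
    also have "\<dots> = (\<Sum>s<2 * Suc N. c s * A s)"
    proof -
      have "(\<Sum>n<M. c (2 * n) * A (2 * n)) = (\<Sum>s<2 * M. c s * A s)" for M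
        by (induction M) (use c_odd in simp_all)
      then show ?thesis .
    qed
    also have "\<dots> = (\<Sum>s\<le>N. c s * A s)"
      by (rule sum.mono_neutral_right) (auto simp: A_eq_0)
    also have "\<dots> = (\<Sum>s\<le>N. \<Sum>m\<le>s. of_nat (s choose m) *
        ((-2) ^ m * pochhammer b m / pochhammer (2 * b) m) * A s)"
      by (simp add: c_def sum_distrib_right)
    \<comment> \<open>The triangle m \<le> s \<le> N is resummed with i = s - m.\<close>
    also have "\<dots> = (\<Sum>m\<le>N. \<Sum>i\<le>N - m. of_nat ((m + i) choose m) *
        ((-2) ^ m * pochhammer b m / pochhammer (2 * b) m) * A (m + i))"
      unfolding sum.Sigma[OF finite_atMost ballI[OF finite_atMost]]
      by (rule sum.reindex_bij_witness[of _ "\<lambda>(m, i). (m + i, m)" "\<lambda>(s, m). (m, s - m)"]) auto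
    also have "\<dots> = (\<Sum>m\<le>N. t m * (-2) ^ m / (pochhammer e m * K) * (\<Sum>j\<le>p. W m j))"
      by (intro sum.cong refl inner) simp
    finally show ?thesis .
  qed

  \<comment> \<open>The polynomial Y_p and the right-hand series\<close>
  define H where "H = poch_multi (map (\<lambda>h. h - d) hs) ps"
  have F_eq: "H * hypF (- of_nat j # map (\<lambda>h. 1 - h + d) hs)
      (map2 (\<lambda>h q. 1 - h + d - of_nat q) hs ps) 1 = D j" for j
  proof -
    have lists: "map (\<lambda>h. 1 - h + d) hs = map (\<lambda>x. 1 - x) (map (\<lambda>h. h - d) hs)"
      "map2 (\<lambda>h q. 1 - h + d - of_nat q) hs ps
        = map2 (\<lambda>x q. 1 - x - of_nat q) (map (\<lambda>h. h - d) hs) ps"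
      by (simp_all add: zip_map1 split_beta algebra_simps)
    have nz: "poch_vec (map2 (\<lambda>h q. 1 - h + d - of_nat q) hs ps) r \<noteq> 0" for r
      using assms(8) poch_nz by (auto simp: poch_vec_eq_0_iff simp del: set_map)
    \<comment> \<open>Reflection absorbs the prefactor H of Y_p into the summand. Together with
      (-j)_r / r! = (-1)^r C(j,r) the inner series becomes the alternating sum
      \<open>D j\<close>.\<close>
    have ratio: "H * (poch_vec (map (\<lambda>h. 1 - h + d) hs) r
          / poch_vec (map2 (\<lambda>h q. 1 - h + d - of_nat q) hs ps) r)
        = poch_multi (map (\<lambda>h. h - d - of_nat r) hs) ps" for r
      using poch_vec_reflect[of "map (\<lambda>h. h - d) hs" ps r] len nz[of r]
      unfolding lists by (simp add: H_def o_def field_simps)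
    have hyp: "hypF (- of_nat j # map (\<lambda>h. 1 - h + d) hs)
        (map2 (\<lambda>h q. 1 - h + d - of_nat q) hs ps) 1
      = (\<Sum>r\<le>j. poch_vec (- of_nat j # map (\<lambda>h. 1 - h + d) hs) r
          / (poch_vec (map2 (\<lambda>h q. 1 - h + d - of_nat q) hs ps) r * fact r))"
      unfolding hypF_poly_def
      by (subst suminf_finite[of "{..j}"]) (auto simp: pochhammer_of_nat_eq_0_lemma)
    have "H * hypF (- of_nat j # map (\<lambda>h. 1 - h + d) hs)
        (map2 (\<lambda>h q. 1 - h + d - of_nat q) hs ps) 1
      = (\<Sum>r\<le>j. pochhammer (- of_nat j) r / fact r *
        (H * (poch_vec (map (\<lambda>h. 1 - h + d) hs) r
          / poch_vec (map2 (\<lambda>h q. 1 - h + d - of_nat q) hs ps) r)))"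
      unfolding hyp sum_distrib_left by (intro sum.cong refl) (simp add: mult_ac)
    also have "\<dots> = D j"
      unfolding ratio D_def alt_binomial_sum_def pochhammer_neg_of_nat
      by (intro sum.cong refl) simp
    finally show ?thesis .
  qed

  \<comment> \<open>For v = 1 and \<lambda> = -2\<alpha> the last factor of Y_p at t = m has base m
    + d - e + 2\<alpha> + j + 1 = 1 - E - N + (m + j).\<close>
  have Y: "poly (Y_poly hs ps d e (- 2 * \<alpha>) 1 1) (of_nat m)
      = (\<Sum>j\<le>p. D j * pochhammer (d - e + 1) j / fact j * pochhammer (d + of_nat m) j
          * pochhammer (1 - E - of_nat N + of_nat (m + j)) (p - j)) / Gamma (e - d)" for m
    unfolding Y_poly_def Let_def F_eq[symmetric] sum_divide_distrib assms(3)[symmetric] H_def[symmetric]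
    by (simp add: poly_sum poly_pochhammer sum_distrib_left E_def d algebra_simps)

  \<comment> \<open>The term of the right-hand series without its polynomial; the upper and lower
    parameter e have cancelled.\<close>
  define T where "T = (\<lambda>m. t m * 2 ^ m / pochhammer (1 - E - of_nat N + of_nat p) m)"
  have rhs: "hypF_poly [2 * \<alpha>, \<beta> - 1/2, d, e] [2 * \<beta> - 1, e, 1 + d - e + 2 * \<alpha> + of_nat p]
             (Y_poly hs ps d e (- 2 * \<alpha>) 1 1) 2
      = (\<Sum>m\<le>N. T m * poly (Y_poly hs ps d e (- 2 * \<alpha>) 1 1) (of_nat m))"
  proof -
    have "2 * \<beta> - 1 = 2 * b" by (simp add: b_def)
    then have rhs_term: "poch_vec [2 * \<alpha>, \<beta> - 1/2, d, e] m
        / (poch_vec [2 * \<beta> - 1, e, 1 + d - e + 2 * \<alpha> + of_nat p] m * fact m) * Z * 2 ^ m = T m * Z"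
      for m Z
      unfolding E_shift b_def[symmetric]
      using poch_nz[OF nonpos(2), of m] by (simp add: T_def t_def mult_ac)
    show ?thesis
      unfolding hypF_poly_def rhs_term
      by (rule suminf_finite) (auto simp: T_def t_def d pochhammer_of_nat_eq_0_lemma)
  qed

  \<comment> \<open>Termwise comparison of the two double sums\<close>
  have Gamma_E: "Gamma (e - 2 * \<alpha> - d) / Gamma (e - 2 * \<alpha>) = pochhammer E N"
    using pochhammer_Gamma[OF nonpos(3), of N] by (simp add: E_def d)
  have Gamma_e: "Gamma e / Gamma (e - d) = 1 / pochhammer e N"
    using pochhammer_Gamma[OF nonpos(2), of N] by (simp add: d)

  have summand: "t m * (-2) ^ m / (pochhammer e m * K) * W m j
      = pochhammer E N / (pochhammer e N * K * pochhammer (1 - E - of_nat N) p) *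
        (T m * (D j * pochhammer (d - e + 1) j / fact j * pochhammer (d + of_nat m) j
          * pochhammer (1 - E - of_nat N + of_nat (m + j)) (p - j)))"
    if m: "m \<le> N" and j: "j \<le> p" for m j
  \<comment> \<open>If m + j > N, both sides contain the vanishing factor (-(N-m))_j = (d+m)_j.
    Otherwise the reflection identity applies, and the truncated difference N - m - j is a true
    one.\<close>
  proof (cases "m + j \<le> N")
    case False
    then have "pochhammer (- of_nat (N - m) :: complex) j = 0"
      using m by (intro pochhammer_of_nat_eq_0_lemma) linarith
    moreover have "d + of_nat m = - of_nat (N - m)"
      using m by (simp add: d of_nat_diff)
    ultimately show ?thesis by (simp add: W_def del: of_nat_diff)
  next
    case True
    have dm: "- of_nat (N - m) = d + of_nat m"
      using m by (simp add: d of_nat_diff)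
    have de: "d - e + 1 = 1 - e - of_nat N"
      by (simp add: d)
    have e1: "pochhammer e (N - j) = pochhammer e m * pochhammer (e + of_nat m) (N - m - j)"
      using pochhammer_product[of m "N - j" e] True by (simp add: add.commute)
    have E1: "pochhammer (1 - E - of_nat N) (p + m)
        = pochhammer (1 - E - of_nat N) p * pochhammer (1 - E - of_nat N + of_nat p) m"
      by (rule pochhammer_product')
    have nz: "pochhammer e N \<noteq> 0" "pochhammer e m \<noteq> 0" "pochhammer (e + of_nat m) (N - m - j) \<noteq> 0"
        "pochhammer (1 - E - of_nat N) p \<noteq> 0" "pochhammer (1 - E - of_nat N + of_nat p) m \<noteq> 0"
      using poch_nz[OF nonpos(2), of N] poch_nz[OF nonpos(2), of "N - j"] assms(11)
        poch_nz[OF nonpos(4), of m] unfolding e1 E_shift by auto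
    have two: "(-2 :: complex) ^ m = (-1) ^ m * 2 ^ m"
      by (simp flip: power_mult_distrib)
    have "(-1) ^ m * pochhammer E (N - m - j) / (pochhammer e m * pochhammer (e + of_nat m) (N - m - j))
        = pochhammer E N * pochhammer (1 - e - of_nat N) j
           * pochhammer (1 - E - of_nat N + of_nat (m + j)) (p - j)
           / (pochhammer e N * (pochhammer (1 - E - of_nat N) p
              * pochhammer (1 - E - of_nat N + of_nat p) m))"
      using pochhammer_reflection_identity[OF True j, of E e] nz
      unfolding e1 E1 by (simp add: frac_eq_eq mult_ac)
    then have "(t m * 2 ^ m / K * (D j / fact j * pochhammer (d + of_nat m) j)) *
          ((-1) ^ m * pochhammer E (N - m - j) / (pochhammer e m * pochhammer (e + of_nat m) (N - m - j)))
        = (t m * 2 ^ m / K * (D j / fact j * pochhammer (d + of_nat m) j)) *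
          (pochhammer E N * pochhammer (1 - e - of_nat N) j
           * pochhammer (1 - E - of_nat N + of_nat (m + j)) (p - j)
           / (pochhammer e N * (pochhammer (1 - E - of_nat N) p
              * pochhammer (1 - E - of_nat N + of_nat p) m)))"
      by simp
    then show ?thesis
      unfolding W_def T_def dm de two by (simp add: mult_ac)
  qed

  \<comment> \<open>The factor 1/\<Gamma>(e - d) of Y_p joins the constant C, so that both Gamma
    quotients become Pochhammer symbols of length N.\<close>
  have const: "Gamma (e - 2 * \<alpha> - d) * Gamma e /
           (Gamma (e - 2 * \<alpha>) * K * pochhammer (1 - E - of_nat N) p) * (x / Gamma (e - d))
      = pochhammer E N / (pochhammer e N * K * pochhammer (1 - E - of_nat N) p) * x" for x
  proof -
    have "Gamma (e - 2 * \<alpha> - d) * Gamma e /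
           (Gamma (e - 2 * \<alpha>) * K * pochhammer (1 - E - of_nat N) p) * (x / Gamma (e - d))
        = (Gamma (e - 2 * \<alpha> - d) / Gamma (e - 2 * \<alpha>)) * (Gamma e / Gamma (e - d))
          * (x / (K * pochhammer (1 - E - of_nat N) p))"
      by (simp add: mult_ac)
    then show ?thesis
      unfolding Gamma_E Gamma_e by (simp add: mult_ac)
  qed

  define S where "S = (\<lambda>m. \<Sum>j\<le>p. D j * pochhammer (d - e + 1) j / fact j * pochhammer (d + of_nat m) j
          * pochhammer (1 - E - of_nat N + of_nat (m + j)) (p - j))"
  have "(\<Sum>m\<le>N. t m * (-2) ^ m / (pochhammer e m * K) * (\<Sum>j\<le>p. W m j))
      = pochhammer E N / (pochhammer e N * K * pochhammer (1 - E - of_nat N) p) * (\<Sum>m\<le>N. T m * S m)"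
    unfolding S_def sum_distrib_left using summand by (intro sum.cong refl) simp
  also have "\<dots> = Gamma (e - 2 * \<alpha> - d) * Gamma e /
           (Gamma (e - 2 * \<alpha>) * K * pochhammer (1 - E - of_nat N) p)
         * (\<Sum>m\<le>N. T m * (S m / Gamma (e - d)))"
    by (simp only: const[symmetric] times_divide_eq_right[of "T _"] sum_divide_distrib)
  finally show ?thesis
    unfolding lhs rhs Y S_def unfolding K_def[symmetric] E_shift .
qed
end
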